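(* Let $(a_n)_{n\ge0}$, $(b_n)_{n\ge0}$, $(c_n)_{n\ge1}$ be real sequences and let the polynomials $q_n$ be defined by the recurrence $$q_0(x)=1,\qquad q_1(x)=a_0x+b_0,\qquad q_{n+1}(x)=(a_nx+b_n)q_n(x)+c_nq_{n-1}(x),\quad n=1,2,3,\ldots,$$ and assume $q_n(0)\neq0$ for all $n$. Then the polynomials $r_n(x)=q_n(x)/q_n(0)$ and $s_n(x)=(1-r_{n+1}(x))/x$ satisfy $$r_0(x)=1,\qquad r_1(x)=1-a'_0x,\qquad s_0(x)=a'_0,\qquad s_1(x)=a'_1x+b'_1,$$ and, for $n\ge2$, $$r_{n+1}(x)=(a'_nx+b'_n)r_n(x)+c'_nr_{n-1}(x),\qquad s_n(x)=(a'_nx+b'_n)s_{n-1}(x)+c'_ns_{n-2}(x)-a'_n,$$ where $$a'_0=-\frac{a_0}{b_0},\qquad a'_1=-\frac{a_0a_1}{b_0b_1+c_1},\qquad b'_1=-\frac{a_0b_1+a_1b_0}{b_0b_1+c_1},$$ $$a'_n=a_n\gamma_n,\qquad b'_n=b_n\gamma_n,\qquad c'_n=c_n\gamma_{n-1}\gamma_n\qquad(n\ge2),$$ and $\gamma_n=q_n(0)/q_{n+1}(0)$ satisfies the recurrence $$\gamma_1=\frac{b_0}{b_0b_1+c_1},\qquad \gamma_n=\frac{1}{b_n+c_n\gamma_{n-1}}\quad(n\ge2).$$ *)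

theory Defs
  imports Complex_Main "HOL-Computational_Algebra.Polynomial"
begin

end

theory Submission
  imports Defs
begin

text \<open>
  At \<open>0\<close> the \<open>a\<^sub>n\<close> terms disappear, so that for \<open>n \<ge> 1\<close>
  \<open>q\<^sub>n\<^sub>+\<^sub>1(0) = b\<^sub>n q\<^sub>n(0) + c\<^sub>n q\<^sub>n\<^sub>-\<^sub>1(0)\<close>.  Dividing by \<open>q\<^sub>n\<^sub>+\<^sub>1(0)\<close> gives
  \<open>\<gamma>\<^sub>n (b\<^sub>n + c\<^sub>n \<gamma>\<^sub>n\<^sub>-\<^sub>1) = 1\<close>, so the denominator in the recurrence for \<open>\<gamma>\<close> cannot vanish;
  the other denominators are \<open>q\<^sub>1(0)\<close> and \<open>q\<^sub>2(0)\<close>.  Dividing the polynomial recurrence by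
  \<open>q\<^sub>n\<^sub>+\<^sub>1(0)\<close> in the same way gives the recurrence for \<open>r\<close>, and for its coefficients
  the identity for \<open>\<gamma>\<close> reads \<open>b'\<^sub>n + c'\<^sub>n = 1\<close>.

  Since \<open>r\<^sub>n(0) = 1\<close>, the quotient defining \<open>s\<^sub>n\<close> is exact, so \<open>r\<^sub>n\<^sub>+\<^sub>1 = 1 - x s\<^sub>n\<close>.  Substituting
  this in the recurrence for \<open>r\<close>, the constant terms cancel exactly because \<open>b'\<^sub>n + c'\<^sub>n = 1\<close>;
  what remains is divisible by \<open>x\<close>, with quotient the recurrence for \<open>s\<close>
  (lemma \<open>quotient_recurrence\<close>).
\<close>

lemma X_dvd_iff_poly_0:
  fixes p :: "'a :: comm_ring_1 poly"
  shows "[:0, 1:] dvd p \<longleftrightarrow> poly p 0 = 0"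
  using poly_eq_0_iff_dvd[of p 0] by simp

lemma eq_div_X:
  fixes p u :: "'a :: field poly"
  assumes "p = [:0, 1:] * u"
  shows "p div [:0, 1:] = u"
  unfolding assms by (rule nonzero_mult_div_cancel_left) simp

text \<open>
  With \<open>\<beta> + \<delta> = 1\<close> the constant sequence \<open>1\<close> solves the recurrence up to the term \<open>\<alpha> x\<close>.
  Hence the deviations from \<open>1\<close>, all multiples of \<open>x\<close>, solve it with that term as an
  inhomogeneity, and dividing by \<open>x\<close> turns \<open>\<alpha> x\<close> into the constant \<open>\<alpha>\<close>.
\<close>

lemma quotient_recurrence:
  fixes R0 R1 R2 S0 S1 S2 :: "'a :: idom poly"
  assumes rec: "R2 = [:\<beta>, \<alpha>:] * R1 + smult \<delta> R0"
    and one: "\<beta> + \<delta> = 1"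
    and S: "1 - R0 = [:0, 1:] * S0" "1 - R1 = [:0, 1:] * S1" "1 - R2 = [:0, 1:] * S2"
  shows "S2 = [:\<beta>, \<alpha>:] * S1 + smult \<delta> S0 - [:\<alpha>:]"
proof -
  have const: "[:\<beta>:] + [:\<delta>:] = 1"
    using one by (simp add: one_pCons)
  have lin: "[:\<beta>, \<alpha>:] = [:\<beta>:] + [:0, 1:] * [:\<alpha>:]"
    by simp
  have sm: "smult \<delta> p = [:\<delta>:] * p" for p
    by simp
  have "[:0, 1:] * S2 = [:0, 1:] * ([:\<beta>, \<alpha>:] * S1 + smult \<delta> S0 - [:\<alpha>:])"
    using S rec const unfolding lin sm by algebra
  then show ?thesis
    by (subst (asm) mult_cancel_left) simp
qed

theorem lemma5p1:
  fixes a b c :: "nat \<Rightarrow> real"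
    and q r s :: "nat \<Rightarrow> real poly"
    and \<gamma> a' b' c' :: "nat \<Rightarrow> real"
  assumes q_0: "q 0 = 1"
    and q_1: "q 1 = [:b 0, a 0:]"
    and q_rec: "\<And>n. n \<ge> 1 \<Longrightarrow> q (n + 1) = [:b n, a n:] * q n + smult (c n) (q (n - 1))"
    and q_nz: "\<And>n. poly (q n) 0 \<noteq> 0"
    and r_eq: "\<And>n. r n = smult (1 / poly (q n) 0) (q n)"
    and s_eq: "\<And>n. s n = (1 - r (n + 1)) div [:0, 1:]"
    and \<gamma>_eq: "\<And>n. \<gamma> n = poly (q n) 0 / poly (q (n + 1)) 0"
    and a'_0: "a' 0 = - (a 0 / b 0)"
    and a'_1: "a' 1 = - ((a 0 * a 1) / (b 0 * b 1 + c 1))"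
    and b'_1: "b' 1 = - ((a 0 * b 1 + a 1 * b 0) / (b 0 * b 1 + c 1))"
    and a'_n: "\<And>n. n \<ge> 2 \<Longrightarrow> a' n = a n * \<gamma> n"
    and b'_n: "\<And>n. n \<ge> 2 \<Longrightarrow> b' n = b n * \<gamma> n"
    and c'_n: "\<And>n. n \<ge> 2 \<Longrightarrow> c' n = c n * \<gamma> (n - 1) * \<gamma> n"
  shows "(\<forall>n. [:0, 1:] dvd 1 - r (n + 1))
    \<and> b 0 \<noteq> 0 \<and> b 0 * b 1 + c 1 \<noteq> 0 \<and> (\<forall>n\<ge>2. b n + c n * \<gamma> (n - 1) \<noteq> 0)
    \<and> r 0 = 1 \<and> r 1 = 1 - [:0, a' 0:]
    \<and> s 0 = [:a' 0:] \<and> s 1 = [:b' 1, a' 1:]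
    \<and> (\<forall>n\<ge>2. r (n + 1) = [:b' n, a' n:] * r n + smult (c' n) (r (n - 1)))
    \<and> (\<forall>n\<ge>2. s n = [:b' n, a' n:] * s (n - 1) + smult (c' n) (s (n - 2)) - [:a' n:])
    \<and> \<gamma> 1 = b 0 / (b 0 * b 1 + c 1)
    \<and> (\<forall>n\<ge>2. \<gamma> n = 1 / (b n + c n * \<gamma> (n - 1)))"
proof -
  define g where "g n = poly (q n) 0" for n
  have g_nz: "g n \<noteq> 0" for n
    using q_nz by (simp add: g_def)
  have g_0: "g 0 = 1" and g_1: "g 1 = b 0"
    by (simp_all add: g_def q_0 q_1 del: One_nat_def)
  have g_rec: "g (n + 1) = b n * g n + c n * g (n - 1)" if "n \<ge> 1" for n
    using q_rec[OF that] by (simp add: g_def)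
  have g_2: "g 2 = b 0 * b 1 + c 1"
    using g_rec[of 1] g_0 g_1 by (simp add: mult.commute numeral_2_eq_2)
  have q_2: "q 2 = [:b 1, a 1:] * [:b 0, a 0:] + [:c 1:]"
    using q_rec[of 1] q_0 q_1 by (simp add: numeral_2_eq_2)
  have r_g: "r n = smult (1 / g n) (q n)" for n
    by (simp add: r_eq g_def)
  have \<gamma>_g: "\<gamma> n = g n / g (n + 1)" for n
    by (simp add: \<gamma>_eq g_def)

  have \<gamma>_mult: "\<gamma> n * (b n + c n * \<gamma> (n - 1)) = 1" if "n \<ge> 1" for n
  proof -
    have "g (n + 1) = g n * (b n + c n * \<gamma> (n - 1))"
      using that g_nz[of n] g_rec[OF that] by (simp add: \<gamma>_g distrib_left)
    then show ?thesis
      using g_nz[of "n + 1"] by (simp add: \<gamma>_g)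
  qed
  have denominator_nz: "b n + c n * \<gamma> (n - 1) \<noteq> 0" if "n \<ge> 1" for n
    using \<gamma>_mult[OF that] by auto
  have \<gamma>_rec: "\<gamma> n = 1 / (b n + c n * \<gamma> (n - 1))" if "n \<ge> 1" for n
    using \<gamma>_mult[OF that] denominator_nz[OF that] by (simp add: field_simps)
  have \<gamma>_1: "\<gamma> 1 = b 0 / (b 0 * b 1 + c 1)"
    using g_1 g_2 by (simp add: \<gamma>_g numeral_2_eq_2)

  have X_dvd: "[:0, 1:] dvd 1 - r n" for n
    using g_nz[of n] by (simp add: X_dvd_iff_poly_0 r_g flip: g_def)
  have X_s: "1 - r (n + 1) = [:0, 1:] * s n" for n
    unfolding s_eq by (rule dvd_mult_div_cancel[OF X_dvd, symmetric])

  have r_0: "r 0 = 1"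
    by (simp add: r_g g_0 q_0)
  have r_1: "r 1 = 1 - [:0, a' 0:]"
    using g_nz[of 1] unfolding r_g q_1 g_1 a'_0 by (simp add: one_pCons)
  have s_0: "s 0 = [:a' 0:]"
    unfolding s_eq by (rule eq_div_X) (use r_1 in simp)
  have s_1: "s 1 = [:b' 1, a' 1:]"
    unfolding s_eq
  proof (rule eq_div_X)
    have "r (1 + 1) = smult (1 / g 2) (q 2)"
      using r_g[of 2] by (simp add: numeral_2_eq_2)
    then show "1 - r (1 + 1) = [:0, 1:] * [:b' 1, a' 1:]"
      using g_nz[of 2] unfolding q_2 a'_1 b'_1 g_2[symmetric]
      by (simp add: one_pCons g_2 field_simps del: One_nat_def)
  qed

  have r_rec: "r (n + 1) = [:b' n, a' n:] * r n + smult (c' n) (r (n - 1))"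
    if "n \<ge> 2" for n
  proof -
    have coeffs: "[:b' n, a' n:] = smult (\<gamma> n) [:b n, a n:]"
      using that by (simp add: a'_n b'_n)
    have g_n: "\<gamma> n * (1 / g n) = 1 / g (n + 1)"
      using g_nz[of n] by (simp add: \<gamma>_g)
    have g_n': "c' n * (1 / g (n - 1)) = 1 / g (n + 1) * c n"
      using that g_nz[of n] g_nz[of "n - 1"] by (simp add: c'_n \<gamma>_g)
    have "[:b' n, a' n:] * r n + smult (c' n) (r (n - 1))
        = smult (\<gamma> n * (1 / g n)) ([:b n, a n:] * q n)
          + smult (c' n * (1 / g (n - 1))) (q (n - 1))"
      unfolding coeffs r_g by (simp only: mult_smult_left mult_smult_right smult_smult mult.commute)
    also have "\<dots> = smult (1 / g (n + 1)) (q (n + 1))"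
      unfolding g_n g_n' using that
      by (simp only: q_rec[of n] smult_add_right smult_smult)
    finally show ?thesis
      by (simp only: r_g)
  qed
  have s_rec: "s n = [:b' n, a' n:] * s (n - 1) + smult (c' n) (s (n - 2)) - [:a' n:]"
    if n: "n \<ge> 2" for n
  proof (rule quotient_recurrence[OF r_rec[OF n]])
    show "b' n + c' n = 1"
      using \<gamma>_mult[of n] n by (simp add: b'_n c'_n algebra_simps)
    have "n - 2 + 1 = n - 1" "n - 1 + 1 = n"
      using n by simp_all
    then show "1 - r (n - 1) = [:0, 1:] * s (n - 2)" "1 - r n = [:0, 1:] * s (n - 1)"
      using X_s[of "n - 2"] X_s[of "n - 1"] by simp_all
  qed (rule X_s)

  have denominators_1_2: "b 0 \<noteq> 0" "b 0 * b 1 + c 1 \<noteq> 0"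
    using g_nz[of 1] g_nz[of 2] g_1 g_2 by simp_all
  show ?thesis
    by (intro conjI allI impI X_dvd denominators_1_2 denominator_nz r_0 r_1 s_0 s_1
        r_rec s_rec \<gamma>_1 \<gamma>_rec) simp_all
qed

end
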